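(* Let $(X,\tau)$ be a Hausdorff quasi-locally convex real topological vector space whose topology $\tau$ is induced by a total family $\{q_\lambda\}_{\lambda\in\Lambda}$ of quasi-weaknorms (as in the definition of quasi-locally convex topological vector space). Let $C$ be a nonempty compact convex subset of $X$. Then every continuous mapping $f: C\to C$ has a fixed point, i.e. there is $x_0\in C$ with $f(x_0)=x_0$.
   Context: All vector spaces are real; $\mathbb{R}^+=[0,\infty)$; $\theta$ denotes the origin of $X$. Weaknorm: a mapping $p: X\to\mathbb{R}^+$ on a vector space $X$ such that (W1) $p(x)\ge 0$ for all $x\in X$ and $p(\theta)=0$; (W2) $p(-x)=p(x)$ for all $x\in X$; (W3) $p(\alpha x_1+(1-\alpha)x_2)\le \alpha p(x_1)+(1-\alpha)p(x_2)$ for all $x_1,x_2\in X$ and $0\le\alpha\le 1$. Quasi-weaknorm: a mapping $q: X\to\mathbb{R}^+$ for which there exist a weaknorm $p$ on $X$ (called the adjoint weaknorm of $q$) and a strictly increasing continuous function $\varphi:\mathbb{R}^+\to\mathbb{R}^+$ (called the associated weighted function of $q$) such that (W4) $q(x)\le\varphi(p(x))$ for all $x\in X$; (W5) $\varphi(0)=0$. Quasi-locally convex topological vector space: a topological vector space $(X,\tau)$ for which there is a family $\{q_\lambda\}_{\lambda\in\Lambda}$ of $\tau$-continuous quasi-weaknorms on $X$, with $\tau$-continuous adjoint weaknorms $\{p_\lambda\}_{\lambda\in\Lambda}$ and associated weighted functions $\{\varphi_\lambda\}_{\lambda\in\Lambda}$, such that $\tau$ is the initial topology induced by $\{q_\lambda\}_{\lambda\in\Lambda}$,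 i.e. $\tau$ is the coarsest topology on $X$ for which all mappings $x\mapsto q_\lambda(x-y)$, $y\in X$, $\lambda\in\Lambda$, are continuous. Total: the family $\{q_\lambda\}_{\lambda\in\Lambda}$ is total if, whenever $x\in X$ satisfies $q_\lambda(x)=0$ for every $\lambda\in\Lambda$, then $x=\theta$. *)

theory Defs
  imports "HOL-Analysis.Analysis"
begin

text \<open>
  A topological vector space is a type of class \<open>real_vector\<close> together with a topology
  \<open>\<tau>\<close>, kept as an explicit value so that it can be compared with other topologies on the
  same vector space.  No separation axiom is included.
\<close>

definition topological_vector_space :: "'a::real_vector topology \<Rightarrow> bool" where
  "topological_vector_space \<tau> \<longleftrightarrow>
     topspace \<tau> = UNIV \<and>
     continuous_map (prod_topology \<tau> \<tau>) \<tau> (\<lambda>(x, y). x + y) \<and>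
     continuous_map (prod_topology euclideanreal \<tau>) \<tau> (\<lambda>(a, x). a *\<^sub>R x)"

definition weaknorm :: "('a::real_vector \<Rightarrow> real) \<Rightarrow> bool" where
  "weaknorm p \<longleftrightarrow>
     (\<forall>x. p x \<ge> 0) \<and> p 0 = 0 \<and>
     (\<forall>x. p (- x) = p x) \<and>
     (\<forall>x\<^sub>1 x\<^sub>2 \<alpha>. 0 \<le> \<alpha> \<and> \<alpha> \<le> 1 \<longrightarrow>
        p (\<alpha> *\<^sub>R x\<^sub>1 + (1 - \<alpha>) *\<^sub>R x\<^sub>2) \<le> \<alpha> * p x\<^sub>1 + (1 - \<alpha>) * p x\<^sub>2)"

text \<open>
  Functions on \<open>\<real>\<^sup>+ = [0, \<infinity>)\<close> are rendered as functions on \<open>real\<close>, of which only the values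
  on \<open>{0..}\<close> are constrained.
\<close>

definition weighted_function :: "(real \<Rightarrow> real) \<Rightarrow> bool" where
  "weighted_function \<phi> \<longleftrightarrow>
     \<phi> \<in> {0..} \<rightarrow> {0..} \<and> strict_mono_on {0..} \<phi> \<and> continuous_on {0..} \<phi> \<and> \<phi> 0 = 0"

definition quasi_weaknorm_with ::
    "('a::real_vector \<Rightarrow> real) \<Rightarrow> ('a \<Rightarrow> real) \<Rightarrow> (real \<Rightarrow> real) \<Rightarrow> bool" where
  "quasi_weaknorm_with q p \<phi> \<longleftrightarrow>
     (\<forall>x. q x \<ge> 0) \<and> weaknorm p \<and> weighted_function \<phi> \<and> (\<forall>x. q x \<le> \<phi> (p x))"

definition translates_continuous ::
    "'a::real_vector topology \<Rightarrow> 'i set \<Rightarrow> ('i \<Rightarrow> 'a \<Rightarrow> real) \<Rightarrow> bool" where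
  "translates_continuous \<sigma> \<Lambda> q \<longleftrightarrow>
     (\<forall>l\<in>\<Lambda>. \<forall>y. continuous_map \<sigma> euclideanreal (\<lambda>x. q l (x - y)))"

definition initial_topology_of ::
    "'a::real_vector topology \<Rightarrow> 'i set \<Rightarrow> ('i \<Rightarrow> 'a \<Rightarrow> real) \<Rightarrow> bool" where
  "initial_topology_of \<tau> \<Lambda> q \<longleftrightarrow>
     topspace \<tau> = UNIV \<and> translates_continuous \<tau> \<Lambda> q \<and>
     (\<forall>\<sigma>. topspace \<sigma> = UNIV \<and> translates_continuous \<sigma> \<Lambda> q \<longrightarrow>
        (\<forall>U. openin \<tau> U \<longrightarrow> openin \<sigma> U))"

text \<open>
  The space \<open>(X, \<tau>)\<close> is quasi-locally convex, as witnessed by the family \<open>q\<close> indexed by \<open>\<Lambda>\<close>.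
\<close>

definition quasi_locally_convex_by ::
    "'a::real_vector topology \<Rightarrow> 'i set \<Rightarrow> ('i \<Rightarrow> 'a \<Rightarrow> real) \<Rightarrow> bool" where
  "quasi_locally_convex_by \<tau> \<Lambda> q \<longleftrightarrow>
     topological_vector_space \<tau> \<and>
     (\<exists>p \<phi>. \<forall>l\<in>\<Lambda>. quasi_weaknorm_with (q l) (p l) (\<phi> l) \<and>
        continuous_map \<tau> euclideanreal (q l) \<and> continuous_map \<tau> euclideanreal (p l)) \<and>
     initial_topology_of \<tau> \<Lambda> q"

definition total_family :: "'i set \<Rightarrow> ('i \<Rightarrow> 'a::real_vector \<Rightarrow> real) \<Rightarrow> bool" where
  "total_family \<Lambda> q \<longleftrightarrow> (\<forall>x. (\<forall>l\<in>\<Lambda>. q l x = 0) \<longrightarrow> x = 0)"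

end

theory Submission
  imports Defs
begin

text \<open>
  The family \<open>q\<close> enters through its adjoint weaknorms \<open>p\<close>: if all \<open>p l x\<close> vanish, then so
  do all \<open>q l x \<le> \<phi> l (p l x)\<close>, because \<open>\<phi> l 0 = 0\<close>, and totality gives \<open>x = 0\<close>.  So the
  weaknorms \<open>p l\<close> are \<open>\<tau>\<close>-continuous convex functions that separate the points of the space, and
  the theorem becomes one of Schauder--Tychonoff type.

  A fixed point is a point \<open>z\<close> with \<open>p l (z - f z) = 0\<close> for all \<open>l\<close>.  By compactness of \<open>C\<close> it is
  enough to satisfy finitely many inequalities \<open>p l (z - f z) \<le> 1 / Suc m\<close> at a time, and these
  follow from a single inequality \<open>P (z - f z) \<le> \<epsilon>\<close> for the finite sum \<open>P\<close> of the weaknorms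
  involved, which is again convex and continuous (\<open>schauder_tychonoff_weaknorms\<close>).

  For one convex function \<open>P\<close>, Schauder's projection replaces \<open>f\<close> by a map of \<open>C\<close> into the convex
  hull of a finite \<open>\<epsilon>\<close>-net that moves each value of \<open>f\<close> by at most \<open>\<epsilon>\<close> as measured by \<open>P\<close>; this
  estimate is Jensen's inequality for \<open>P\<close> (\<open>schauder_almost_fixed_point\<close>).  A fixed point of the
  projected map comes from Brouwer's theorem, applied to the coefficients of a convex combination
  rather than to the points themselves (\<open>barycentric_fixed_point\<close>).

  The size of the net, and hence the dimension for Brouwer's theorem, depends on \<open>\<epsilon>\<close> and \<open>P\<close>, so
  it cannot be carried by a type.  The theorem is therefore derived for cubes in
  \<open>nat \<Rightarrow> real\<close> from Kuhn's combinatorial lemma (\<open>brouwer_unit_cube\<close>).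
\<close>

section \<open>Brouwer's theorem for cubes of arbitrary dimension\<close>

text \<open>
  Coordinates from \<open>n\<close> on are set to \<open>0\<close>, so that the cubes of all dimensions are compact subsets
  of one type.
\<close>

definition unit_cube :: "nat \<Rightarrow> (nat \<Rightarrow> real) set" where
  "unit_cube n = {u. (\<forall>i. 0 \<le> u i \<and> u i \<le> 1) \<and> (\<forall>i\<ge>n. u i = 0)}"

lemma compact_unit_cube: "compact (unit_cube n)"
proof -
  have eq: "unit_cube n = Pi\<^sub>E UNIV (\<lambda>i. if i < n then {0..1} else {0})"
    unfolding unit_cube_def PiE_UNIV_domain
    by (fastforce simp: Pi_iff split: if_splits)
  have "compactin (product_topology (\<lambda>i. euclideanreal) UNIV)
          (Pi\<^sub>E UNIV (\<lambda>i::nat. if i < n then {0..1} else {0}))"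
    unfolding compactin_PiE by auto
  then show ?thesis
    unfolding eq by (simp add: euclidean_product_topology)
qed

lemma tendsto_fun_iff:
  fixes f :: "'c \<Rightarrow> 'i \<Rightarrow> 'b::topological_space"
  shows "(f \<longlongrightarrow> u) F \<longleftrightarrow> (\<forall>i. ((\<lambda>c. f c i) \<longlongrightarrow> u i) F)"
  using limitin_componentwise[of "\<lambda>_. euclidean" UNIV f u F]
  by (simp add: euclidean_product_topology)

definition grid_point :: "nat \<Rightarrow> nat \<Rightarrow> (nat \<Rightarrow> nat) \<Rightarrow> nat \<Rightarrow> real" where
  "grid_point n k x = (\<lambda>i. if i < n then real (x i) / real (Suc k) else 0)"

lemma grid_point_in_unit_cube:
  "(\<And>i. i < n \<Longrightarrow> x i \<le> Suc k) \<Longrightarrow> grid_point n k x \<in> unit_cube n"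
  by (fastforce simp: grid_point_def unit_cube_def simp flip: of_nat_Suc)

text \<open>
  The mesh \<open>1 / Suc (\<sigma> k)\<close> tends to \<open>0\<close>, so all vertices of the chosen grid cells have the same limit.
\<close>

lemma tendsto_grid_neighbours:
  assumes lim: "(\<lambda>k. grid_point n (\<sigma> k) (q k)) \<longlonglongrightarrow> u"
    and \<sigma>: "strict_mono \<sigma>"
    and near: "\<And>k j. j < n \<Longrightarrow> q k j \<le> r k j \<and> r k j \<le> q k j + 1"
  shows "(\<lambda>k. grid_point n (\<sigma> k) (r k)) \<longlonglongrightarrow> u"
proof -
  have mesh: "(\<lambda>k. 1 / real (Suc (\<sigma> k))) \<longlonglongrightarrow> 0"
    using LIMSEQ_subseq_LIMSEQ[OF LIMSEQ_inverse_real_of_nat \<sigma>]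
    by (simp add: o_def inverse_eq_divide)
  have "(\<lambda>k. grid_point n (\<sigma> k) (r k) i) \<longlonglongrightarrow> u i" for i
  proof (rule tendsto_sandwich)
    show Q: "(\<lambda>k. grid_point n (\<sigma> k) (q k) i) \<longlonglongrightarrow> u i"
      using lim by (simp add: tendsto_fun_iff)
    show "(\<lambda>k. grid_point n (\<sigma> k) (q k) i + 1 / real (Suc (\<sigma> k))) \<longlonglongrightarrow> u i"
      using tendsto_add[OF Q mesh] by simp
    show "\<forall>\<^sub>F k in sequentially. grid_point n (\<sigma> k) (q k) i \<le> grid_point n (\<sigma> k) (r k) i"
      using near[of i] by (auto simp: grid_point_def divide_right_mono)
    have "real (r k i) \<le> real (q k i) + 1" if "i < n" for k
      using near[OF that, of k] by linarith
    then show "\<forall>\<^sub>F k in sequentially.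
        grid_point n (\<sigma> k) (r k) i \<le> grid_point n (\<sigma> k) (q k) i + 1 / real (Suc (\<sigma> k))"
      by (auto simp: grid_point_def divide_right_mono simp flip: add_divide_distrib)
  qed
  then show ?thesis
    by (simp add: tendsto_fun_iff)
qed

text \<open>
  Kuhn's lemma yields a grid cell with lowest corner \<open>q\<close> which, for each coordinate \<open>i\<close>, has one vertex
  where \<open>g\<close> does not decrease the \<open>i\<close>-th coordinate and one where it does not increase it.  Such a
  cell is the discrete substitute for a fixed point.
\<close>

lemma grid_approximate_fixed_point:
  fixes g :: "(nat \<Rightarrow> real) \<Rightarrow> nat \<Rightarrow> real"
  assumes g: "\<And>u i. u \<in> unit_cube n \<Longrightarrow> i < n \<Longrightarrow> 0 \<le> g u i \<and> g u i \<le> 1"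
  shows "\<exists>q. (\<forall>j<n. q j \<le> k) \<and>
    (\<forall>i<n. \<exists>r s. (\<forall>j<n. q j \<le> r j \<and> r j \<le> q j + 1) \<and> (\<forall>j<n. q j \<le> s j \<and> s j \<le> q j + 1) \<and>
       grid_point n k r i \<le> g (grid_point n k r) i \<and>
       g (grid_point n k s) i \<le> grid_point n k s i)"
proof -
  let ?G = "grid_point n k"
  \<comment> \<open>The label records the direction in which \<open>g\<close> moves a coordinate.  Ties get label \<open>1\<close>,
    except on the face \<open>x i = 0\<close>, where Kuhn's lemma prescribes \<open>0\<close>; label \<open>0\<close> still means that
    the coordinate is not decreased there, since \<open>g\<close> has values in \<open>[0, 1]\<close>.\<close>
  define label :: "(nat \<Rightarrow> nat) \<Rightarrow> nat \<Rightarrow> nat" where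
    "label x i = (if x i = 0 then 0 else if g (?G x) i \<le> ?G x i then 1 else 0)" for x i
  have lab0: "?G x i \<le> g (?G x) i"
    if "label x i = 0" "i < n" "\<forall>j<n. x j \<le> Suc k" for x i
    using that g[OF grid_point_in_unit_cube, of x k i]
    by (auto simp: label_def grid_point_def split: if_splits)
  have lab1: "g (?G x) i \<le> ?G x i" if "label x i \<noteq> 0" for x i
    using that by (auto simp: label_def split: if_splits)
  have edge: "label x i = 1" if "x i = Suc k" "i < n" "\<forall>j<n. x j \<le> Suc k" for x i
  proof -
    have "?G x i = 1"
      using that by (simp add: grid_point_def)
    then show ?thesis
      using that g[OF grid_point_in_unit_cube, of x k i] by (simp add: label_def)
  qed
  obtain q where q: "\<forall>i<n. q i < Suc k"
    and rs: "\<forall>i<n. \<exists>r s. (\<forall>j<n. q j \<le> r j \<and> r j \<le> q j + 1) \<and>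
        (\<forall>j<n. q j \<le> s j \<and> s j \<le> q j + 1) \<and> label r i \<noteq> label s i"
  proof (rule kuhn_lemma[of "Suc k" n label])
    show "\<forall>x. (\<forall>i<n. x i \<le> Suc k) \<longrightarrow> (\<forall>i<n. x i = Suc k \<longrightarrow> label x i = 1)"
      using edge by blast
  qed (auto simp: label_def)
  have "\<exists>r s. (\<forall>j<n. q j \<le> r j \<and> r j \<le> q j + 1) \<and> (\<forall>j<n. q j \<le> s j \<and> s j \<le> q j + 1) \<and>
      ?G r i \<le> g (?G r) i \<and> g (?G s) i \<le> ?G s i" if i: "i < n" for i
  proof -
    obtain r s where r: "\<forall>j<n. q j \<le> r j \<and> r j \<le> q j + 1"
      and s: "\<forall>j<n. q j \<le> s j \<and> s j \<le> q j + 1" and ne: "label r i \<noteq> label s i"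
      using rs i by blast
    have le: "\<forall>j<n. r j \<le> Suc k" "\<forall>j<n. s j \<le> Suc k"
      using r s q by fastforce+
    show ?thesis
    proof (cases "label r i = 0")
      case True
      then show ?thesis
        using lab0[OF True i le(1)] lab1[of s i] ne r s by metis
    next
      case False
      have "label s i = 0"
        using False ne by (auto simp: label_def split: if_splits)
      then show ?thesis
        using lab0[OF _ i le(2)] lab1[OF False] r s by metis
    qed
  qed
  then show ?thesis
    using q by (metis less_Suc_eq_le)
qed

text \<open>
  The cells from the previous lemma accumulate at some \<open>u\<close>.  By continuity, the opposite inequalities
  at their vertices both pass to the limit, which forces \<open>g u i = u i\<close>.
\<close>

theorem brouwer_unit_cube:
  fixes g :: "(nat \<Rightarrow> real) \<Rightarrow> nat \<Rightarrow> real"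
  assumes cont: "\<And>i. i < n \<Longrightarrow> continuous_on (unit_cube n) (\<lambda>u. g u i)"
    and g: "\<And>u i. u \<in> unit_cube n \<Longrightarrow> i < n \<Longrightarrow> 0 \<le> g u i \<and> g u i \<le> 1"
  shows "\<exists>u\<in>unit_cube n. \<forall>i<n. g u i = u i"
proof -
  obtain q where q: "\<And>k j. j < n \<Longrightarrow> q k j \<le> k"
    and rs: "\<And>k. \<forall>i<n. \<exists>r s. (\<forall>j<n. q k j \<le> r j \<and> r j \<le> q k j + 1) \<and>
       (\<forall>j<n. q k j \<le> s j \<and> s j \<le> q k j + 1) \<and>
       grid_point n k r i \<le> g (grid_point n k r) i \<and>
       g (grid_point n k s) i \<le> grid_point n k s i"
    using grid_approximate_fixed_point[of n g, OF g] by metis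
  have "seq_compact (unit_cube n)"
    by (rule compact_imp_seq_compact[OF compact_unit_cube])
  moreover have "\<forall>k. grid_point n k (q k) \<in> unit_cube n"
    using q by (auto intro!: grid_point_in_unit_cube simp: le_SucI)
  ultimately obtain u \<sigma> where u: "u \<in> unit_cube n" and \<sigma>: "strict_mono \<sigma>"
    and "((\<lambda>k. grid_point n k (q k)) \<circ> \<sigma>) \<longlonglongrightarrow> u"
    by (rule seq_compactE)
  then have lim: "(\<lambda>k. grid_point n (\<sigma> k) (q (\<sigma> k))) \<longlonglongrightarrow> u"
    by (simp add: o_def)
  have "g u i = u i" if i: "i < n" for i
  proof -
    have "\<forall>k. \<exists>r s. (\<forall>j<n. q k j \<le> r j \<and> r j \<le> q k j + 1) \<and>
       (\<forall>j<n. q k j \<le> s j \<and> s j \<le> q k j + 1) \<and>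
       grid_point n k r i \<le> g (grid_point n k r) i \<and>
       g (grid_point n k s) i \<le> grid_point n k s i"
      using rs i by blast
    then obtain r s where r: "\<And>k j. j < n \<Longrightarrow> q k j \<le> r k j \<and> r k j \<le> q k j + 1"
      and s: "\<And>k j. j < n \<Longrightarrow> q k j \<le> s k j \<and> s k j \<le> q k j + 1"
      and gr: "\<And>k. grid_point n k (r k) i \<le> g (grid_point n k (r k)) i"
      and gs: "\<And>k. g (grid_point n k (s k)) i \<le> grid_point n k (s k) i"
      by metis
    have limits: "(\<lambda>k. grid_point n (\<sigma> k) (t (\<sigma> k)) i) \<longlonglongrightarrow> u i"
      "(\<lambda>k. g (grid_point n (\<sigma> k) (t (\<sigma> k))) i) \<longlonglongrightarrow> g u i"
      if t: "\<And>k j. j < n \<Longrightarrow> q k j \<le> t k j \<and> t k j \<le> q k j + 1" for t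
    proof -
      have tu: "(\<lambda>k. grid_point n (\<sigma> k) (t (\<sigma> k))) \<longlonglongrightarrow> u"
        by (rule tendsto_grid_neighbours[OF lim \<sigma>]) (rule t)
      then show "(\<lambda>k. grid_point n (\<sigma> k) (t (\<sigma> k)) i) \<longlonglongrightarrow> u i"
        by (simp add: tendsto_fun_iff)
      have "grid_point n k (t k) \<in> unit_cube n" for k
      proof (rule grid_point_in_unit_cube)
        show "t k j \<le> Suc k" if "j < n" for j
          using t[OF that, of k] q[OF that, of k] by linarith
      qed
      then show "(\<lambda>k. g (grid_point n (\<sigma> k) (t (\<sigma> k))) i) \<longlonglongrightarrow> g u i"
        by (intro continuous_on_tendsto_compose[OF cont[OF i] tu u]) auto
    qed
    have "u i \<le> g u i"
      by (rule LIMSEQ_le[OF limits(1)[OF r] limits(2)[OF r]]) (use gr in auto)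
    moreover have "g u i \<le> u i"
      by (rule LIMSEQ_le[OF limits(2)[OF s] limits(1)[OF s]]) (use gs in auto)
    ultimately show ?thesis
      by simp
  qed
  with u show ?thesis
    by blast
qed

section \<open>Fixed points of finite-dimensional maps in a topological vector space\<close>

lemma continuous_map_add_tvs:
  assumes "topological_vector_space \<tau>" "continuous_map X \<tau> f" "continuous_map X \<tau> g"
  shows "continuous_map X \<tau> (\<lambda>x. f x + g x)"
proof -
  have "continuous_map (prod_topology \<tau> \<tau>) \<tau> (\<lambda>(x, y). x + y)"
    using assms(1) by (simp add: topological_vector_space_def)
  from continuous_map_compose[OF continuous_map_pairedI[OF assms(2,3)] this]
  show ?thesis
    by (simp add: o_def)
qed

lemma continuous_map_scaleR_tvs:
  assumes "topological_vector_space \<tau>" "continuous_map X euclideanreal a" "continuous_map X \<tau> g"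
  shows "continuous_map X \<tau> (\<lambda>x. a x *\<^sub>R g x)"
proof -
  have "continuous_map (prod_topology euclideanreal \<tau>) \<tau> (\<lambda>(a, x). a *\<^sub>R x)"
    using assms(1) by (simp add: topological_vector_space_def)
  from continuous_map_compose[OF continuous_map_pairedI[OF assms(2,3)] this]
  show ?thesis
    by (simp add: o_def)
qed

lemma continuous_map_sum_tvs:
  assumes "topological_vector_space \<tau>" "\<And>i. i \<in> I \<Longrightarrow> continuous_map X \<tau> (f i)"
  shows "continuous_map X \<tau> (\<lambda>x. \<Sum>i\<in>I. f i x)"
  using assms(2)
proof (induction I rule: infinite_finite_induct)
  case (insert i I)
  then show ?case
    by (simp add: continuous_map_add_tvs[OF assms(1)])
qed (use assms(1) in \<open>auto simp: topological_vector_space_def\<close>)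

lemma continuous_map_diff_tvs:
  assumes "topological_vector_space \<tau>" "continuous_map X \<tau> f" "continuous_map X \<tau> g"
  shows "continuous_map X \<tau> (\<lambda>x. f x - g x)"
  using continuous_map_add_tvs[OF assms(1,2)
      continuous_map_scaleR_tvs[OF assms(1) _ assms(3), of "\<lambda>_. - 1"]]
  by simp

lemma continuous_on_coordinate [continuous_intros]: "continuous_on S (\<lambda>u. u i)"
  by (rule continuous_on_product_then_coordinatewise[OF continuous_on_id])

text \<open>
  A continuous retraction of the cube onto the standard simplex: a coordinate sum below \<open>1\<close> is
  filled up at the vertex \<open>0\<close>, and one above \<open>1\<close> is scaled down.
\<close>

definition barycentric :: "nat \<Rightarrow> (nat \<Rightarrow> real) \<Rightarrow> nat \<Rightarrow> real" where
  "barycentric n u i =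
     (u i + (if i = 0 then max 0 (1 - (\<Sum>j<n. u j)) else 0)) / max 1 (\<Sum>j<n. u j)"

lemma sum_barycentric:
  assumes "n > 0"
  shows "(\<Sum>i<n. barycentric n u i) = 1"
proof -
  have "(\<Sum>i<n. u i + (if i = 0 then max 0 (1 - (\<Sum>j<n. u j)) else 0))
      = (\<Sum>i<n. u i) + max 0 (1 - (\<Sum>j<n. u j))"
    using assms by (simp add: sum.distrib)
  also have "\<dots> = max 1 (\<Sum>j<n. u j)"
    by linarith
  finally show ?thesis
    by (simp add: barycentric_def flip: sum_divide_distrib)
qed

lemma barycentric_id: "(\<Sum>j<n. u j) = 1 \<Longrightarrow> barycentric n u = u"
  by (simp add: barycentric_def fun_eq_iff)

text \<open>
  The map \<open>y \<mapsto> \<Sum>i<n. c i y *\<^sub>R x i\<close> factors through its coefficients, so its fixed points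
  correspond to those of the map that sends a coefficient vector \<open>u\<close> to the coefficients \<open>c\<close> at the
  point with barycentric coordinates \<open>u\<close>.  The latter is a self-map of a cube.  The retraction
  \<open>barycentric\<close> leaves no trace, because a fixed vector has coordinate sum \<open>1\<close> as the \<open>c i\<close> do.
  Arguing with coefficients avoids choosing coordinates on the span of the \<open>x i\<close>.
\<close>

lemma barycentric_fixed_point:
  fixes \<tau> :: "'a::real_vector topology" and n :: nat
  assumes tvs: "topological_vector_space \<tau>" and "convex C" and "n > 0"
    and x: "\<And>i. i < n \<Longrightarrow> x i \<in> C"
    and c: "\<And>i. i < n \<Longrightarrow> continuous_map (subtopology \<tau> C) euclideanreal (c i)"
    and c_nonneg: "\<And>i y. i < n \<Longrightarrow> y \<in> C \<Longrightarrow> 0 \<le> c i y"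
    and c_sum: "\<And>y. y \<in> C \<Longrightarrow> (\<Sum>i<n. c i y) = 1"
  shows "\<exists>z\<in>C. z = (\<Sum>i<n. c i z *\<^sub>R x i)"
proof -
  define pt where "pt u = (\<Sum>i<n. barycentric n u i *\<^sub>R x i)" for u
  have pt_in: "pt u \<in> C" if "u \<in> unit_cube n" for u
    unfolding pt_def
    using that x sum_barycentric[OF \<open>n > 0\<close>, of u]
    by (intro convex_sum \<open>convex C\<close>) (auto simp: unit_cube_def barycentric_def)
  have "continuous_map (top_of_set (unit_cube n)) \<tau> pt"
    unfolding pt_def
  proof (intro continuous_map_sum_tvs[OF tvs] continuous_map_scaleR_tvs[OF tvs])
    fix i :: nat
    have "continuous_on (unit_cube n) (\<lambda>u. if i = 0 then max 0 (1 - (\<Sum>j<n. u j)) else 0)"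
      by (cases "i = 0") (auto intro!: continuous_intros)
    then have "continuous_on (unit_cube n) (\<lambda>u. barycentric n u i)"
      unfolding barycentric_def by (intro continuous_intros) auto
    then show "continuous_map (top_of_set (unit_cube n)) euclideanreal (\<lambda>u. barycentric n u i)"
      by simp
  qed (use tvs in \<open>auto simp: topological_vector_space_def\<close>)
  then have pt: "continuous_map (top_of_set (unit_cube n)) (subtopology \<tau> C) pt"
    by (rule continuous_map_into_subtopology) (auto simp: pt_in)
  have "\<exists>u\<in>unit_cube n. \<forall>i<n. c i (pt u) = u i"
  proof (rule brouwer_unit_cube)
    show "continuous_on (unit_cube n) (\<lambda>u. c i (pt u))" if "i < n" for i
      using continuous_map_compose[OF pt c[OF that]] by (simp add: o_def)
    show "0 \<le> c i (pt u) \<and> c i (pt u) \<le> 1" if "u \<in> unit_cube n" "i < n" for u i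
    proof -
      have "c i (pt u) \<le> (\<Sum>j<n. c j (pt u))"
        by (rule member_le_sum) (use that c_nonneg pt_in in auto)
      then show ?thesis
        using that c_nonneg pt_in c_sum by simp
    qed
  qed
  then obtain u where u: "u \<in> unit_cube n" and fix_u: "\<And>i. i < n \<Longrightarrow> c i (pt u) = u i"
    by blast
  have "(\<Sum>i<n. u i) = 1"
    using c_sum[OF pt_in[OF u]] fix_u by simp
  then have "pt u = (\<Sum>i<n. u i *\<^sub>R x i)"
    by (simp add: pt_def barycentric_id)
  also have "\<dots> = (\<Sum>i<n. c i (pt u) *\<^sub>R x i)"
    by (intro sum.cong) (auto simp: fix_u)
  finally have "pt u = (\<Sum>i<n. c i (pt u) *\<^sub>R x i)" .
  with pt_in[OF u] show ?thesis
    by blast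
qed

section \<open>Almost fixed points with respect to a convex function\<close>

lemma weaknorm_imp_convex_on:
  assumes "weaknorm p"
  shows "convex_on UNIV p"
proof (rule convex_onI)
  fix t :: real and x y
  assume "0 < t" "t < 1"
  have "0 \<le> \<alpha> \<and> \<alpha> \<le> 1 \<longrightarrow> p (\<alpha> *\<^sub>R x + (1 - \<alpha>) *\<^sub>R y) \<le> \<alpha> * p x + (1 - \<alpha>) * p y" for \<alpha>
    using assms by (simp add: weaknorm_def)
  from this[of "1 - t"]
  show "p ((1 - t) *\<^sub>R x + t *\<^sub>R y) \<le> (1 - t) * p x + t * p y"
    using \<open>0 < t\<close> \<open>t < 1\<close> by simp
qed simp

lemma convex_on_finite_sum:
  assumes "\<And>l. l \<in> F \<Longrightarrow> convex_on S (p l)" "convex S"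
  shows "convex_on S (\<lambda>x. \<Sum>l\<in>F. p l x)"
  using assms(1)
proof (induction F rule: infinite_finite_induct)
  case (insert l F)
  then show ?case
    by (simp add: convex_on_add)
qed (use \<open>convex S\<close> in \<open>auto simp: convex_on_def\<close>)

text \<open>
  The coefficient of a net point \<open>x i\<close> in the projection of \<open>f z\<close> is nonzero only if
  \<open>p (x i - f z) < \<epsilon>\<close>.  If \<open>z\<close> equals that projection, then \<open>z - f z\<close> is a convex combination of the
  corresponding vectors \<open>x i - f z\<close>, and Jensen's inequality gives the bound.
\<close>

lemma schauder_almost_fixed_point:
  fixes \<tau> :: "'a::real_vector topology"
  assumes tvs: "topological_vector_space \<tau>"
    and p: "convex_on UNIV p" "continuous_map \<tau> euclideanreal p" "p 0 = 0"
    and C: "C \<noteq> {}" "compactin \<tau> C" "convex C"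
    and f: "continuous_map (subtopology \<tau> C) (subtopology \<tau> C) f"
    and "\<epsilon> > 0"
  shows "\<exists>z\<in>C. p (z - f z) \<le> \<epsilon>"
proof -
  have UNIV: "topspace \<tau> = UNIV"
    using tvs by (simp add: topological_vector_space_def)
  have p_diff: "continuous_map \<tau> euclideanreal (\<lambda>y. p (a - y))" for a
  proof -
    have "continuous_map \<tau> \<tau> (\<lambda>y. a - y)"
      by (rule continuous_map_diff_tvs[OF tvs]) (auto simp: UNIV)
    from continuous_map_compose[OF this p(2)] show ?thesis
      by (simp add: o_def)
  qed
  define U where "U a = {y. p (a - y) < \<epsilon>}" for a
  have "openin \<tau> (U a)" for a
    using openin_continuous_map_preimage[OF p_diff[of a], of "{..<\<epsilon>}"] by (simp add: UNIV U_def)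
  moreover have "C \<subseteq> \<Union> (U ` C)"
    using \<open>\<epsilon> > 0\<close> p(3) by (auto simp: U_def)
  ultimately obtain \<F> where "finite \<F>" "\<F> \<subseteq> U ` C" "C \<subseteq> \<Union> \<F>"
    using C(2) unfolding compactin_def by (metis imageE)
  then obtain N where N: "finite N" "N \<subseteq> C" "C \<subseteq> \<Union> (U ` N)"
    by (metis finite_subset_image)
  define n where "n = card N"
  obtain x where x: "bij_betw x {..<n} N"
    using ex_bij_betw_nat_finite[OF N(1)] by (auto simp: n_def atLeast0LessThan)
  have x_in: "x i \<in> C" if "i < n" for i
    using that x N(2) by (auto simp: bij_betw_def)
  have "n > 0"
    using N C(1) by (auto simp: n_def card_gt_0_iff)
  define w where "w i y = max 0 (\<epsilon> - p (x i - y))" for i y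
  have w_pos: "(\<Sum>i<n. w i y) > 0" if y: "y \<in> C" for y
  proof -
    obtain a where "a \<in> N" "y \<in> U a"
      using N(3) y by blast
    then obtain i where "i < n" "w i y > 0"
      using x by (auto simp: bij_betw_def U_def w_def)
    then show ?thesis
      by (intro sum_pos2[of _ i]) (auto simp: w_def)
  qed
  define c where "c i y = w i (f y) / (\<Sum>j<n. w j (f y))" for i y
  have f_in: "f y \<in> C" if "y \<in> C" for y
    using f that by (auto simp: continuous_map_def UNIV)
  have c_sum: "(\<Sum>i<n. c i y) = 1" if "y \<in> C" for y
    using w_pos[OF f_in[OF that]] by (simp add: c_def flip: sum_divide_distrib)
  have c_nonneg: "0 \<le> c i y" if "y \<in> C" for i y
    using w_pos[OF f_in[OF that]] by (simp add: c_def w_def)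
  have c_cont: "continuous_map (subtopology \<tau> C) euclideanreal (c i)" for i
  proof -
    have f': "continuous_map (subtopology \<tau> C) \<tau> f"
      using f continuous_map_in_subtopology by blast
    have "continuous_map (subtopology \<tau> C) euclideanreal (\<lambda>y. w j (f y))" for j
    proof -
      have "continuous_map \<tau> euclideanreal (w j)"
        unfolding w_def by (intro continuous_intros p_diff) auto
      from continuous_map_compose[OF f' this] show ?thesis
        by (simp add: o_def)
    qed
    then show ?thesis
      unfolding c_def using w_pos f_in
      by (intro continuous_intros) (fastforce simp: UNIV)+
  qed
  obtain z where z: "z \<in> C" and fix_z: "z = (\<Sum>i<n. c i z *\<^sub>R x i)"
    using barycentric_fixed_point[OF tvs C(3) \<open>n > 0\<close>, of x c] x_in c_cont c_nonneg c_sum by blast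
  have "z - f z = (\<Sum>i<n. c i z *\<^sub>R x i) - (\<Sum>i<n. c i z) *\<^sub>R f z"
    using fix_z c_sum[OF z] by simp
  also have "\<dots> = (\<Sum>i<n. c i z *\<^sub>R (x i - f z))"
    by (simp add: scaleR_diff_right sum_subtractf scaleR_left.sum)
  finally have "p (z - f z) \<le> (\<Sum>i<n. c i z * p (x i - f z))"
    using convex_on_sum[OF _ _ p(1) c_sum[OF z], of "\<lambda>i. x i - f z"] c_nonneg[OF z] \<open>n > 0\<close>
    by (auto simp: lessThan_empty_iff)
  also have "\<dots> \<le> (\<Sum>i<n. c i z * \<epsilon>)"
  proof (rule sum_mono)
    fix i
    show "c i z * p (x i - f z) \<le> c i z * \<epsilon>"
    proof (cases "p (x i - f z) \<le> \<epsilon>")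
      case True
      then show ?thesis
        using c_nonneg[OF z] by (simp add: mult_left_mono)
    next
      case False
      then show ?thesis
        by (simp add: c_def w_def)
    qed
  qed
  also have "\<dots> = \<epsilon>"
    using c_sum[OF z] by (simp flip: sum_distrib_right)
  finally show ?thesis
    using z by blast
qed

section \<open>The fixed point theorem\<close>

text \<open>
  The sets \<open>A (l, m)\<close> of points moved by at most \<open>1 / Suc m\<close> with respect to \<open>p l\<close> are closed in \<open>C\<close>
  and have the finite intersection property; points of their intersection are fixed.
\<close>

theorem schauder_tychonoff_weaknorms:
  fixes \<tau> :: "'a::real_vector topology"
  assumes tvs: "topological_vector_space \<tau>"
    and p: "\<And>l. l \<in> \<Lambda> \<Longrightarrow> weaknorm (p l)" "\<And>l. l \<in> \<Lambda> \<Longrightarrow> continuous_map \<tau> euclideanreal (p l)"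
    and separating: "\<And>x. (\<And>l. l \<in> \<Lambda> \<Longrightarrow> p l x = 0) \<Longrightarrow> x = 0"
    and C: "C \<noteq> {}" "compactin \<tau> C" "convex C"
    and f: "continuous_map (subtopology \<tau> C) (subtopology \<tau> C) f"
  shows "\<exists>z\<in>C. f z = z"
proof -
  have UNIV: "topspace \<tau> = UNIV"
    using tvs by (simp add: topological_vector_space_def)
  define A where "A = (\<lambda>(l, m). {z \<in> C. p l (z - f z) \<le> 1 / real (Suc m)})"
  have closed: "closedin (subtopology \<tau> C) (A (l, m))" if l: "l \<in> \<Lambda>" for l m
  proof -
    have "continuous_map (subtopology \<tau> C) \<tau> (\<lambda>z. z - f z)"
      using f by (intro continuous_map_diff_tvs[OF tvs]) (auto simp: continuous_map_in_subtopology)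
    from continuous_map_compose[OF this p(2)[OF l]]
    have "continuous_map (subtopology \<tau> C) euclideanreal (\<lambda>z. p l (z - f z))"
      by (simp add: o_def)
    from closedin_continuous_map_preimage[OF this, of "{..1 / real (Suc m)}"]
    show ?thesis
      by (simp add: A_def UNIV)
  qed
  have fip: "\<Inter> (A ` J) \<noteq> {}" if J: "finite J" "J \<subseteq> \<Lambda> \<times> UNIV" for J
  proof (cases "J = {}")
    case False
    define P where "P x = (\<Sum>l\<in>fst ` J. p l x)" for x
    define \<epsilon> where "\<epsilon> = Min ((\<lambda>j. 1 / real (Suc (snd j))) ` J)"
    have sub: "fst ` J \<subseteq> \<Lambda>"
      using J(2) by auto
    have "\<epsilon> > 0"
      using J(1) False by (simp add: \<epsilon>_def)
    have "\<exists>z\<in>C. P (z - f z) \<le> \<epsilon>"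
    proof (rule schauder_almost_fixed_point[OF tvs _ _ _ C f \<open>\<epsilon> > 0\<close>])
      show "convex_on UNIV P"
        unfolding P_def using sub p(1)
        by (intro convex_on_finite_sum) (auto intro: weaknorm_imp_convex_on)
      show "continuous_map \<tau> euclideanreal P"
        unfolding P_def using sub p(2) J(1) by (intro continuous_map_sum) auto
      show "P 0 = 0"
        unfolding P_def using sub p(1) by (intro sum.neutral) (auto simp: weaknorm_def)
    qed
    then obtain z where z: "z \<in> C" "P (z - f z) \<le> \<epsilon>"
      by blast
    have "z \<in> A j" if j: "j \<in> J" for j
    proof -
      have "p (fst j) (z - f z) \<le> P (z - f z)"
        unfolding P_def using J(1) j sub p(1)
        by (intro member_le_sum) (auto simp: weaknorm_def)
      also have "\<dots> \<le> 1 / real (Suc (snd j))"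
        using z(2) J(1) j by (auto simp: \<epsilon>_def intro: order_trans Min_le)
      finally show ?thesis
        using z(1) by (simp add: A_def split_def)
    qed
    then show ?thesis
      by blast
  qed auto
  have "compact_space (subtopology \<tau> C)"
    using C(2) by (simp add: compactin_subspace)
  moreover have "\<forall>D\<in>A ` (\<Lambda> \<times> UNIV). closedin (subtopology \<tau> C) D"
    using closed by auto
  moreover have "\<forall>\<F>. finite \<F> \<and> \<F> \<subseteq> A ` (\<Lambda> \<times> UNIV) \<longrightarrow> \<Inter> \<F> \<noteq> {}"
    using fip by (metis finite_subset_image)
  ultimately have "\<Inter> (A ` (\<Lambda> \<times> UNIV)) \<noteq> {}"
    unfolding compact_space_fip by blast
  then obtain z\<^sub>1 where z\<^sub>1: "\<And>l m. l \<in> \<Lambda> \<Longrightarrow> z\<^sub>1 \<in> A (l, m)"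
    by fastforce
  \<comment> \<open>For empty \<open>\<Lambda>\<close> the intersection is over no sets at all, so \<open>z\<^sub>1\<close> need not lie in \<open>C\<close>.\<close>
  obtain z where "z \<in> C" and z: "\<And>l m. l \<in> \<Lambda> \<Longrightarrow> z \<in> A (l, m)"
  proof (cases "\<Lambda> = {}")
    case True
    then show ?thesis
      using that C(1) by blast
  next
    case False
    then have "z\<^sub>1 \<in> C"
      using z\<^sub>1 by (auto simp: A_def)
    then show ?thesis
      using that z\<^sub>1 by blast
  qed
  have le: "p l (z - f z) \<le> 1 / real (Suc m)" if "l \<in> \<Lambda>" for l m
    using z[OF that, of m] by (simp add: A_def)
  have "p l (z - f z) = 0" if l: "l \<in> \<Lambda>" for l
  proof (rule antisym)
    have "(\<lambda>m. 1 / real (Suc m)) \<longlonglongrightarrow> 0"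
      using LIMSEQ_inverse_real_of_nat by (simp add: inverse_eq_divide)
    then show "p l (z - f z) \<le> 0"
      by (rule LIMSEQ_le_const) (use le[OF l] in auto)
    show "0 \<le> p l (z - f z)"
      using p(1)[OF l] by (simp add: weaknorm_def)
  qed
  then have "z - f z = 0"
    by (rule separating)
  then have "f z = z"
    by simp
  with \<open>z \<in> C\<close> show ?thesis
    by blast
qed

theorem theorem4p1:
  fixes \<tau> :: "'a::real_vector topology"
    and \<Lambda> :: "'i set" and q :: "'i \<Rightarrow> 'a \<Rightarrow> real"
    and C :: "'a set" and f :: "'a \<Rightarrow> 'a"
  assumes "quasi_locally_convex_by \<tau> \<Lambda> q"
    and "Hausdorff_space \<tau>"
    and "total_family \<Lambda> q"
    and "C \<noteq> {}" and "compactin \<tau> C" and "convex C"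
    and "continuous_map (subtopology \<tau> C) (subtopology \<tau> C) f"
  shows "\<exists>x\<^sub>0\<in>C. f x\<^sub>0 = x\<^sub>0"
proof -
  obtain p \<phi> where tvs: "topological_vector_space \<tau>"
    and q: "\<And>l. l \<in> \<Lambda> \<Longrightarrow> quasi_weaknorm_with (q l) (p l) (\<phi> l)"
    and p: "\<And>l. l \<in> \<Lambda> \<Longrightarrow> continuous_map \<tau> euclideanreal (p l)"
    using assms(1) unfolding quasi_locally_convex_by_def by blast
  show ?thesis
  proof (rule schauder_tychonoff_weaknorms[OF tvs _ p _ assms(4-7)])
    show "weaknorm (p l)" if "l \<in> \<Lambda>" for l
      using q[OF that] by (simp add: quasi_weaknorm_with_def)
    show "x = 0" if x: "\<And>l. l \<in> \<Lambda> \<Longrightarrow> p l x = 0" for x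
    proof -
      have "q l x = 0" if l: "l \<in> \<Lambda>" for l
      proof (rule antisym)
        have "q l x \<le> \<phi> l (p l x)" "\<phi> l 0 = 0"
          using q[OF l] by (auto simp: quasi_weaknorm_with_def weighted_function_def)
        then show "q l x \<le> 0"
          by (simp add: x[OF l])
        show "0 \<le> q l x"
          using q[OF l] by (simp add: quasi_weaknorm_with_def)
      qed
      then show "x = 0"
        using assms(3) unfolding total_family_def by blast
    qed
  qed
qed

end
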